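(* Let $R=\mathbb{Z}$ or $R=\mathbb{F}_p$ with $p$ prime. A minimal involutive generating set of $ESL_5(R)$ consists of $3$ involutions. For instance, the three matrices $$I_{12} = \begin{pmatrix} -1 & 1 & 0 & 0 & 0\\ 0 & 1 & 0 & 0 & 0\\ 0 & 0 & 1 & 0 & 0\\ 0 & 0 & 0 & 1 & 0\\ 0 & 0 & 0 & 0 & 1\end{pmatrix},\quad D_1 = \begin{pmatrix} 0 & 0 & 0 & 0 & -1\\ 0 & 0 & 0 & 1 & 0\\ 0 & 0 & -1 & 0 & 0\\ 0 & 1 & 0 & 0 & 0\\ -1 & 0 & 0 & 0 & 0\end{pmatrix},\quad F_L = \begin{pmatrix} 1 & 0 & 0 & 0 & 0\\ 0 & 0 & 0 & 0 & 1\\ 0 & 0 & 0 & 1 & 0\\ 0 & 0 & 1 & 0 & 0\\ 0 & 1 & 0 & 0 & 0\end{pmatrix}$$ form such a minimal involutive generating set.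
   Context: For a commutative ring $R$, $ESL_n(R)$ denotes the group of all $n\times n$ matrices over $R$ with determinant $1$ or $-1$. An involutive generating set of a group is a generating set all of whose elements are involutions (elements of order $2$); it is minimal if no involutive generating set of smaller cardinality exists. Integer matrices are read modulo $p$ when $R=\mathbb{F}_p$. *)

theory Defs
  imports
    "HOL-Algebra.Multiplicative_Group"
    "HOL-Algebra.Generated_Groups"
    "HOL-Library.Equipollence"
    "Jordan_Normal_Form.Determinant"
    "Berlekamp_Zassenhaus.Finite_Field"
begin

definition ESL :: "nat \<Rightarrow> 'a::comm_ring_1 mat monoid" where
  "ESL n = \<lparr>carrier = {A \<in> carrier_mat n n. det A = 1 \<or> det A = -1},
            mult = (*), one = 1\<^sub>m n\<rparr>"

lemma group_ESL: "group (ESL n :: 'a::comm_ring_1 mat monoid)"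
proof (rule groupI)
  fix A :: "'a mat"
  assume "A \<in> carrier (ESL n)"
  then have A: "A \<in> carrier_mat n n" and d: "det A = 1 \<or> det A = -1"
    by (auto simp: ESL_def)
  note adj = adj_mat[OF A]
  let ?B = "det A \<cdot>\<^sub>m adj_mat A"
  have dd: "det A * det A = 1" using d by auto
  have B: "?B \<in> carrier_mat n n" using adj(1) by simp
  have "?B * A = det A \<cdot>\<^sub>m (det A \<cdot>\<^sub>m 1\<^sub>m n)"
    using mult_smult_assoc_mat[OF adj(1) A] adj(3) by simp
  also have "\<dots> = 1\<^sub>m n"
    by (rule eq_matI) (use dd in \<open>simp_all flip: mult.assoc\<close>)
  finally have BA: "?B * A = 1\<^sub>m n" .
  have "det ?B * det A = 1"
    using det_mult[OF B A] BA by simp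
  with d have "det ?B = 1 \<or> det ?B = -1"
    by (metis mult.right_neutral mult_minus_right minus_minus)
  with B BA show "\<exists>B\<in>carrier (ESL n). B \<otimes>\<^bsub>ESL n\<^esub> A = \<one>\<^bsub>ESL n\<^esub>"
    by (intro bexI[of _ ?B]) (auto simp: ESL_def)
qed (auto simp: ESL_def det_mult assoc_mult_mat)

definition involutive_generating_set :: "('a, 'b) monoid_scheme \<Rightarrow> 'a set \<Rightarrow> bool" where
  "involutive_generating_set G S \<longleftrightarrow>
     S \<subseteq> carrier G \<and> (\<forall>x\<in>S. group.ord G x = 2) \<and> generate G S = carrier G"

text \<open>Cardinalities are compared with \<open>\<prec>\<close>, because \<^const>\<open>card\<close> is \<open>0\<close> on infinite sets.\<close>

definition minimal_involutive_generating_set :: "('a, 'b) monoid_scheme \<Rightarrow> 'a set \<Rightarrow> bool" where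
  "minimal_involutive_generating_set G S \<longleftrightarrow>
     involutive_generating_set G S \<and> (\<nexists>T. involutive_generating_set G T \<and> T \<prec> S)"

definition I12 :: "int mat" where
  "I12 = mat_of_rows_list 5
    [[-1, 1, 0, 0, 0],
     [ 0, 1, 0, 0, 0],
     [ 0, 0, 1, 0, 0],
     [ 0, 0, 0, 1, 0],
     [ 0, 0, 0, 0, 1]]"

definition D1 :: "int mat" where
  "D1 = mat_of_rows_list 5
    [[ 0, 0,  0, 0, -1],
     [ 0, 0,  0, 1,  0],
     [ 0, 0, -1, 0,  0],
     [ 0, 1,  0, 0,  0],
     [-1, 0,  0, 0,  0]]"

definition FL :: "int mat" where
  "FL = mat_of_rows_list 5
    [[1, 0, 0, 0, 0],
     [0, 0, 0, 0, 1],
     [0, 0, 0, 1, 0],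
     [0, 0, 1, 0, 0],
     [0, 1, 0, 0, 0]]"

end

theory Submission
  imports Defs
begin

text \<open>
  Let \<open>e\<^sub>1, \<dots>, e\<^sub>5\<close> be the standard basis. The transvection \<^term>\<open>addrow_mat n c i j\<close> has diagonal
  entries \<open>1\<close> and the coefficient \<open>c\<close> at position \<open>(i, j)\<close>, with \<open>i \<noteq> j\<close>.

  \<^emph>\<open>Three involutions suffice.\<close> Let \<open>R\<close> be a Euclidean ring in which every element is an integer
  multiple of \<open>1\<close>; both rings of the theorem are of this kind. By the Euclidean algorithm applied
  to the columns, every matrix of determinant \<open>1\<close> over \<open>R\<close> is a product of transvections
  (\<open>det_1_in\<close>), and as \<open>det I12 = -1\<close>, it is enough to reach all transvections with coefficient
  \<open>1\<close>. These are integer matrices, so they need to be reached over the integers only: reduction of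
  the entries is a group homomorphism.

  The product of \<open>D1\<close> and \<open>FL\<close> permutes the five lines spanned by the basis vectors cyclically, so a
  transvection can be moved from the first row to any other row by conjugation
  (\<open>rotate_transvection\<close>). For the first row, consider the reflections \<open>x \<mapsto> x + f x \<cdot> e\<^sub>1\<close> with
  \<open>f = -2 e\<^sub>1\<^sup>* + v\<close>, where \<open>v\<close> is a combination of the other four coordinates. The matrix \<open>I12\<close> is one of
  them, and conjugation by an element of the group that fixes the line of \<open>e\<^sub>1\<close> carries one such
  reflection to another. The product of two of them, for \<open>v\<close> and \<open>w\<close>, is
  \<open>x \<mapsto> x + (v - w) x \<cdot> e\<^sub>1\<close>, so the transvections \<open>x \<mapsto> x + u x \<cdot> e\<^sub>1\<close> are in the group for
  all \<open>u\<close> in the lattice spanned by the differences of the available \<open>v\<close>. With six reflections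
  (\<open>reflections_in_three_gen\<close>), this lattice contains all integer \<open>u\<close> (\<open>first_row_transvections\<close>).

  \<^emph>\<open>Two involutions do not suffice.\<close> Two involutions generate a dihedral group. It consists of the
  powers of the product of the two involutions, which commute with each other, and of elements
  squaring to the identity. Hence any two squares commute
  (\<open>squares_commute_if_two_involutions\<close>). The matrices of two 3-cycles with one point in common are
  squares of their inverses and do not commute.
\<close>

section \<open>Groups generated by two involutions\<close>

context group begin

lemma subgroup_mult_left_iff:
  assumes "subgroup H G" "x \<in> H" "y \<in> carrier G"
  shows "x \<otimes> y \<in> H \<longleftrightarrow> y \<in> H"
proof
  assume "x \<otimes> y \<in> H"
  then have "inv x \<otimes> (x \<otimes> y) \<in> H"
    using assms by (auto intro: subgroup.m_closed subgroup.m_inv_closed)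
  moreover have "inv x \<otimes> (x \<otimes> y) = y"
    using assms by (metis inv_solve_left m_closed subgroup.mem_carrier)
  ultimately show "y \<in> H" by simp
qed (use assms in \<open>auto intro: subgroup.m_closed\<close>)

lemma ord_eq_2_iff:
  assumes "x \<in> carrier G"
  shows "ord x = 2 \<longleftrightarrow> x \<noteq> \<one> \<and> x \<otimes> x = \<one>"
proof
  assume o: "ord x = 2"
  then have "x [^] (2::nat) = \<one>" using pow_ord_eq_1[OF assms] by simp
  then show "x \<noteq> \<one> \<and> x \<otimes> x = \<one>" using o assms ord_eq_1 by (auto simp: numeral_2_eq_2)
next
  assume a: "x \<noteq> \<one> \<and> x \<otimes> x = \<one>"
  then have "x [^] (2::nat) = \<one>" using assms by (simp add: numeral_2_eq_2)
  then have "ord x dvd 2" using assms pow_eq_id by blast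
  then have "ord x \<le> 2" "ord x \<noteq> 0" by (auto intro: dvd_imp_le gr0I)
  moreover have "ord x \<noteq> 1" using a assms ord_eq_1 by blast
  ultimately show "ord x = 2" by linarith
qed

lemma nat_pow_intertwine:
  assumes "a \<in> carrier G" "x \<in> carrier G" "y \<in> carrier G" "a \<otimes> x = y \<otimes> a"
  shows "a \<otimes> x [^] (m::nat) = y [^] m \<otimes> a"
proof (induction m)
  case (Suc m)
  have "a \<otimes> x [^] Suc m = (a \<otimes> x [^] m) \<otimes> x" using assms by (simp add: m_assoc)
  also have "\<dots> = y [^] m \<otimes> (a \<otimes> x)" using assms by (simp add: Suc m_assoc)
  also have "\<dots> = y [^] Suc m \<otimes> a" using assms by (simp add: m_assoc)
  finally show ?case .
qed (use assms in simp)

lemma int_pow_intertwine_inv: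
  assumes "a \<in> carrier G" "x \<in> carrier G" "a \<otimes> x = inv x \<otimes> a"
  shows "a \<otimes> x [^] (k::int) = x [^] (- k) \<otimes> a"
proof -
  have "a \<otimes> inv x = x \<otimes> a"
    using assms by (metis inv_closed inv_solve_left inv_solve_right m_assoc m_closed)
  then show ?thesis
    using nat_pow_intertwine[of a x "inv x"] nat_pow_intertwine[of a "inv x" x] assms
    by (cases k rule: int_cases2) (simp_all add: int_pow_neg int_pow_int nat_pow_inv)
qed

text \<open>The multiplication table of a dihedral group, with rotations \<open>c [^] k\<close> and the reflection \<open>a\<close>.\<close>

lemma dihedral_products:
  fixes k l :: int
  assumes a: "a \<in> carrier G" "a \<otimes> a = \<one>" and c: "c \<in> carrier G" "a \<otimes> c = inv c \<otimes> a"
  shows "c [^] k \<otimes> c [^] l = c [^] (k + l)"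
    and "c [^] k \<otimes> (c [^] l \<otimes> a) = c [^] (k + l) \<otimes> a"
    and "c [^] k \<otimes> a \<otimes> c [^] l = c [^] (k - l) \<otimes> a"
    and "c [^] k \<otimes> a \<otimes> (c [^] l \<otimes> a) = c [^] (k - l)"
proof -
  have cl: "c [^] i \<in> carrier G" for i :: int using c by simp
  have add: "c [^] i \<otimes> c [^] j = c [^] (i + j)" for i j :: int
    using int_pow_mult[OF c(1)] by simp
  show "c [^] k \<otimes> c [^] l = c [^] (k + l)" by (rule add)
  show "c [^] k \<otimes> (c [^] l \<otimes> a) = c [^] (k + l) \<otimes> a"
    unfolding add[symmetric] by (rule m_assoc[symmetric, OF cl cl a(1)])
  have "c [^] k \<otimes> a \<otimes> c [^] l = c [^] k \<otimes> (a \<otimes> c [^] l)" by (rule m_assoc[OF cl a(1) cl])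
  also have "\<dots> = c [^] k \<otimes> (c [^] (- l) \<otimes> a)"
    by (simp only: int_pow_intertwine_inv[OF a(1) c])
  also have "\<dots> = c [^] k \<otimes> c [^] (- l) \<otimes> a" by (rule m_assoc[symmetric, OF cl cl a(1)])
  also have "\<dots> = c [^] (k - l) \<otimes> a" by (simp only: add diff_conv_add_uminus)
  finally show *: "c [^] k \<otimes> a \<otimes> c [^] l = c [^] (k - l) \<otimes> a" .
  have "c [^] k \<otimes> a \<otimes> (c [^] l \<otimes> a) = c [^] k \<otimes> a \<otimes> c [^] l \<otimes> a"
    by (rule m_assoc[symmetric, OF m_closed[OF cl a(1)] cl a(1)])
  also have "\<dots> = c [^] (k - l) \<otimes> (a \<otimes> a)" unfolding * by (rule m_assoc[OF cl a(1) a(1)])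
  finally show "c [^] k \<otimes> a \<otimes> (c [^] l \<otimes> a) = c [^] (k - l)" using cl a(2) by simp
qed

lemma involution_inverts_product:
  assumes a: "a \<in> carrier G" "a \<otimes> a = \<one>" and b: "b \<in> carrier G" "b \<otimes> b = \<one>"
  shows "b = inv (a \<otimes> b) \<otimes> a" and "a \<otimes> (a \<otimes> b) = inv (a \<otimes> b) \<otimes> a"
proof -
  have "inv a = a" "inv b = b" using a b by (simp_all add: inv_equality)
  then show "b = inv (a \<otimes> b) \<otimes> a" using a b by (simp add: inv_mult_group m_assoc)
  moreover have "a \<otimes> (a \<otimes> b) = b" using a b by (simp flip: m_assoc)
  ultimately show "a \<otimes> (a \<otimes> b) = inv (a \<otimes> b) \<otimes> a" by simp
qed

text \<open>Conjugation by \<open>a\<close> inverts the rotation \<open>a \<otimes> b\<close>, so every word in \<open>a\<close> and \<open>b\<close> can be sorted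
  into a rotation followed by at most one \<open>a\<close>.\<close>

lemma generate_two_involutions:
  assumes a: "a \<in> carrier G" "a \<otimes> a = \<one>" and b: "b \<in> carrier G" "b \<otimes> b = \<one>"
    and x: "x \<in> generate G {a, b}"
  shows "\<exists>k::int. x = (a \<otimes> b) [^] k \<or> x = (a \<otimes> b) [^] k \<otimes> a"
proof -
  define c where "c = a \<otimes> b"
  have c: "c \<in> carrier G" using a b by (simp add: c_def)
  have inv: "b = inv c \<otimes> a" "a \<otimes> c = inv c \<otimes> a"
    using involution_inverts_product[OF a b] by (simp_all add: c_def)
  have gen: "\<exists>k::int. h = c [^] k \<or> h = c [^] k \<otimes> a" if "h \<in> {a, b}" for h
    using that
  proof (elim insertE emptyE)
    assume "h = a"
    then have "h = c [^] (0::int) \<otimes> a" using a by simp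
    then show ?thesis by blast
  next
    assume "h = b"
    then have "h = c [^] (- 1 :: int) \<otimes> a"
      using inv(1) int_pow_neg[OF c, of 1] int_pow_1[OF c] by simp
    then show ?thesis by blast
  qed
  have inv_gen: "inv h = h" if "h \<in> {a, b}" for h
    using that a b by (auto simp: inv_equality)
  note products = dihedral_products[OF a c inv(2)]
  from x have "\<exists>k::int. x = c [^] k \<or> x = c [^] k \<otimes> a"
  proof (induction rule: generate.induct)
    case one
    have "\<one> = c [^] (0::int)" by simp
    then show ?case by blast
  next
    case (incl h)
    then show ?case by (rule gen)
  next
    case (inv h)
    then show ?case using gen[of h] inv_gen[of h] by simp
  next
    case (eng h1 h2)
    then obtain k l :: int
      where "h1 = c [^] k \<or> h1 = c [^] k \<otimes> a" "h2 = c [^] l \<or> h2 = c [^] l \<otimes> a"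
      by (elim exE)
    then show ?case using products[of k l] by (elim disjE) (hypsubst, blast)+
  qed
  then show ?thesis by (simp only: c_def)
qed

text \<open>The square of a rotation is a rotation, and the square of any other element is the identity; so
  all squares lie in one cyclic subgroup.\<close>

lemma squares_commute_if_two_involutions:
  assumes a: "a \<in> carrier G" "a \<otimes> a = \<one>" and b: "b \<in> carrier G" "b \<otimes> b = \<one>"
    and x: "x \<in> generate G {a, b}" and y: "y \<in> generate G {a, b}"
  shows "(x \<otimes> x) \<otimes> (y \<otimes> y) = (y \<otimes> y) \<otimes> (x \<otimes> x)"
proof -
  define c where "c = a \<otimes> b"
  have c: "c \<in> carrier G" using a b by (simp add: c_def)
  have inv: "a \<otimes> c = inv c \<otimes> a"
    using involution_inverts_product(2)[OF a b] by (simp only: c_def)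
  note products = dihedral_products[OF a c inv]
  have sq: "\<exists>k::int. z \<otimes> z = c [^] k" if z: "z \<in> generate G {a, b}" for z
  proof -
    obtain k :: int where "z = c [^] k \<or> z = c [^] k \<otimes> a"
      using generate_two_involutions[OF a b z] unfolding c_def by (elim exE)
    then show ?thesis using products(1,4)[of k k] by (elim disjE) (hypsubst, blast)+
  qed
  obtain k l :: int where kl: "x \<otimes> x = c [^] k" "y \<otimes> y = c [^] l"
    using sq[OF x] sq[OF y] by (elim exE)
  show ?thesis unfolding kl products(1) by (simp only: add.commute)
qed

end

section \<open>Matrices of determinant one are products of transvections\<close>

lemma ESL_simps:
  "carrier (ESL n) = {A \<in> carrier_mat n n. det A = 1 \<or> det A = -1}"
  "mult (ESL n) = (*)" "one (ESL n) = 1\<^sub>m n"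
  by (simp_all add: ESL_def)

definition unit_columns :: "nat \<Rightarrow> 'a::comm_ring_1 mat \<Rightarrow> bool" where
  "unit_columns k B \<longleftrightarrow> (\<forall>i<dim_row B. \<forall>j<k. B $$ (i, j) = (if i = j then 1 else 0))"

text \<open>Row \<open>l\<close> vanishes in the columns left of \<open>k\<close>, so adding it elsewhere does not spoil them.\<close>

lemma unit_columns_addrow:
  assumes "unit_columns k B" "B \<in> carrier_mat n n" "k \<le> n" "k \<le> l" "l < n"
  shows "unit_columns k (addrow c i l B)"
  using assms by (auto simp: unit_columns_def)

text \<open>Membership in \<open>H\<close> is invariant under adding a multiple of a row to another row, so a matrix lies
  in \<open>H\<close> once it can be turned into the identity by such row operations. The columns are brought into shape from left to right: \<open>unit_columns_suffice k\<close> says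
  that the work from column \<open>k\<close> onwards can be completed.\<close>

locale transvections =
  fixes n :: nat and H :: "'a::euclidean_ring mat set"
  assumes subgroup: "subgroup H (ESL n)"
    and addrow_mat_in: "\<And>i j c. i < n \<Longrightarrow> j < n \<Longrightarrow> i \<noteq> j \<Longrightarrow> addrow_mat n c i j \<in> H"
begin

lemma in_if_addrow_in:
  assumes B: "B \<in> carrier_mat n n" "det B = 1" and ij: "i < n" "j < n" "i \<noteq> j"
    and "addrow c i j B \<in> H"
  shows "B \<in> H"
  using group.subgroup_mult_left_iff[OF group_ESL subgroup addrow_mat_in[OF ij, of c], of B] assms
  by (simp add: ESL_simps addrow_mat[OF B(1)])

definition unit_columns_suffice :: "nat \<Rightarrow> bool" where
  "unit_columns_suffice k \<longleftrightarrow>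
     (\<forall>B \<in> carrier_mat n n. det B = 1 \<longrightarrow> unit_columns k B \<longrightarrow> B \<in> H)"

lemma clear_column:
  assumes IH: "unit_columns_suffice (Suc k)" and k: "k < n"
    and B: "B \<in> carrier_mat n n" "det B = 1" "unit_columns k B" and piv: "B $$ (k, k) = 1"
  shows "B \<in> H"
  using B piv
proof (induction "card {i. i < n \<and> i \<noteq> k \<and> B $$ (i, k) \<noteq> 0}" arbitrary: B rule: less_induct)
  case less
  show ?case
  proof (cases "\<exists>i<n. i \<noteq> k \<and> B $$ (i, k) \<noteq> 0")
    case False
    then have "unit_columns (Suc k) B"
      using less.prems by (auto simp: unit_columns_def less_Suc_eq)
    then show ?thesis using IH less.prems(1,2) by (simp add: unit_columns_suffice_def)
  next
    case True
    then obtain i where i: "i < n" "i \<noteq> k" "B $$ (i, k) \<noteq> 0" by blast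
    let ?B = "addrow (- B $$ (i, k)) i k B"
    have entry: "?B $$ (a, k) = (if a = i then 0 else B $$ (a, k))" if "a < n" for a
      using less.prems(1,4) that k by simp
    have "{a. a < n \<and> a \<noteq> k \<and> ?B $$ (a, k) \<noteq> 0} = {a. a < n \<and> a \<noteq> k \<and> B $$ (a, k) \<noteq> 0} - {i}"
      using entry by (auto split: if_splits)
    moreover have "i \<in> {a. a < n \<and> a \<noteq> k \<and> B $$ (a, k) \<noteq> 0}" using i by simp
    ultimately have smaller: "card {a. a < n \<and> a \<noteq> k \<and> ?B $$ (a, k) \<noteq> 0}
        < card {a. a < n \<and> a \<noteq> k \<and> B $$ (a, k) \<noteq> 0}"
      by (simp only:) (rule card_Diff1_less, simp_all)
    have "?B \<in> H"
    proof (rule less.hyps[OF smaller])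
      show "?B \<in> carrier_mat n n" using less.prems(1) by simp
      show "det ?B = 1" using det_addrow[OF k i(2) less.prems(1)] less.prems(2) by simp
      show "unit_columns k ?B"
        using unit_columns_addrow[OF less.prems(3,1) _ _ k] k by simp
      show "?B $$ (k, k) = 1" using entry[OF k] i(2) less.prems(4) by simp
    qed
    then show ?thesis by (rule in_if_addrow_in[OF less.prems(1,2) i(1) k i(2)])
  qed
qed

lemma last_pivot:
  assumes "B \<in> carrier_mat (Suc k) (Suc k)" "det B = 1" "unit_columns k B"
  shows "B $$ (k, k) = 1"
proof -
  have ut: "upper_triangular B" using assms by (auto simp: unit_columns_def)
  have "diag_mat B = replicate k 1 @ [B $$ (k, k)]"
    using assms by (auto simp: diag_mat_def unit_columns_def list_eq_iff_nth_eq nth_append)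
  then show ?thesis using assms det_upper_triangular[OF ut assms(1)] by simp
qed

text \<open>The unit in row \<open>i\<close> is used to turn the diagonal entry into \<open>1\<close>.\<close>

lemma unit_below_pivot:
  assumes IH: "unit_columns_suffice (Suc k)" and k: "k < n"
    and B: "B \<in> carrier_mat n n" "det B = 1" "unit_columns k B"
    and i: "k < i" "i < n" and u: "B $$ (i, k) dvd 1"
  shows "B \<in> H"
proof -
  obtain v where v: "1 = B $$ (i, k) * v" using u by (auto elim: dvdE)
  let ?B = "addrow ((1 - B $$ (k, k)) * v) k i B"
  have "(1 - B $$ (k, k)) * v * B $$ (i, k) = 1 - B $$ (k, k)"
    using v by (metis mult.assoc mult.commute mult.right_neutral)
  then have one: "?B $$ (k, k) = 1" using B(1) k i by (simp only: index_mat_addrow carrier_matD diff_add_cancel if_True simp_thms)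
  have "?B \<in> H"
  proof (rule clear_column[OF IH k _ _ _ one])
    show "?B \<in> carrier_mat n n" using B(1) by simp
    show "det ?B = 1" using det_addrow[OF i(2) _ B(1), of k] B(2) i(1) by simp
    show "unit_columns k ?B" using unit_columns_addrow[OF B(3,1) _ _ i(2)] k i(1) by simp
  qed
  then show ?thesis using in_if_addrow_in[OF B(1,2) k i(2)] i(1) by simp
qed

text \<open>A unit on the diagonal is first copied, as a \<open>1\<close>, to the row below. There is no such row in the
  last column, but there the matrix is upper triangular and the determinant forces the diagonal
  entry to be \<open>1\<close>.\<close>

lemma unit_in_column:
  assumes IH: "unit_columns_suffice (Suc k)" and k: "k < n"
    and B: "B \<in> carrier_mat n n" "det B = 1" "unit_columns k B"
    and i: "k \<le> i" "i < n" and u: "B $$ (i, k) dvd 1"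
  shows "B \<in> H"
proof (cases "i = k")
  case False
  then have "k < i" using i(1) by simp
  from unit_below_pivot[OF IH k B this i(2) u] show ?thesis .
next
  case True
  show ?thesis
  proof (cases "Suc k = n")
    case True
    have "B $$ (k, k) = 1" using last_pivot[of B k] B True by simp
    then show ?thesis by (rule clear_column[OF IH k B])
  next
    case False
    then have k1: "Suc k < n" using k by simp
    obtain v where v: "1 = B $$ (k, k) * v" using u \<open>i = k\<close> by (auto elim: dvdE)
    let ?B = "addrow ((1 - B $$ (Suc k, k)) * v) (Suc k) k B"
    have "(1 - B $$ (Suc k, k)) * v * B $$ (k, k) = 1 - B $$ (Suc k, k)"
      using v by (metis mult.assoc mult.commute mult.right_neutral)
    then have one: "?B $$ (Suc k, k) = 1"
      using B(1) k k1 by (simp only: index_mat_addrow carrier_matD diff_add_cancel if_True simp_thms)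
    have "?B \<in> H"
    proof (rule unit_below_pivot[OF IH k _ _ _ lessI k1])
      show "?B \<in> carrier_mat n n" using B(1) by simp
      show "det ?B = 1" using det_addrow[OF k _ B(1), of "Suc k"] B(2) by simp
      show "unit_columns k ?B" using unit_columns_addrow[OF B(3,1) _ _ k] k by simp
      show "?B $$ (Suc k, k) dvd 1" unfolding one by simp
    qed
    then show ?thesis using in_if_addrow_in[OF B(1,2) k1 k] by simp
  qed
qed

text \<open>In the inverse of \<open>B\<close>, row \<open>k\<close> vanishes left of the diagonal. Multiplied with column \<open>k\<close> of \<open>B\<close> it
  therefore writes \<open>1\<close> as a combination of the entries of that column from the diagonal downwards.\<close>

lemma common_divisor_unit:
  assumes B: "B \<in> carrier_mat n n" "det B = 1" "unit_columns k B" and k: "k < n"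
    and d: "\<And>j. k \<le> j \<Longrightarrow> j < n \<Longrightarrow> d dvd B $$ (j, k)"
  shows "d dvd 1"
proof -
  define C where "C = adj_mat B"
  have C: "C \<in> carrier_mat n n" "C * B = 1\<^sub>m n"
    using adj_mat[OF B(1)] B(2) by (auto simp: C_def)
  have entry: "(\<Sum>l<n. C $$ (k, l) * B $$ (l, j)) = (if k = j then 1 else 0)" if "j < n" for j
  proof -
    have "(C * B) $$ (k, j) = (\<Sum>l<n. C $$ (k, l) * B $$ (l, j))"
      using B C(1) k that by (auto simp: scalar_prod_def lessThan_atLeast0)
    then show ?thesis using C k that by simp
  qed
  have zero: "C $$ (k, j) = 0" if j: "j < k" for j
  proof -
    have "(\<Sum>l<n. C $$ (k, l) * B $$ (l, j)) = (\<Sum>l<n. if l = j then C $$ (k, l) else 0)"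
      using B j by (intro sum.cong) (auto simp: unit_columns_def)
    then show ?thesis using entry[of j] j k by simp
  qed
  have "d dvd (\<Sum>l<n. C $$ (k, l) * B $$ (l, k))"
  proof (intro dvd_sum)
    fix l assume "l \<in> {..<n}"
    then show "d dvd C $$ (k, l) * B $$ (l, k)"
      using zero[of l] d[of l] by (cases "l < k") auto
  qed
  then show ?thesis using entry[of k] k by simp
qed

text \<open>The Euclidean algorithm: as long as some entry from the diagonal downwards is not a multiple
  of the chosen one, its remainder is a smaller nonzero entry. At the end the chosen entry is a
  common divisor, hence a unit.\<close>

lemma nonzero_in_column:
  assumes IH: "unit_columns_suffice (Suc k)" and k: "k < n"
    and B: "B \<in> carrier_mat n n" "det B = 1" "unit_columns k B"
    and i: "k \<le> i" "i < n" and nz: "B $$ (i, k) \<noteq> 0"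
  shows "B \<in> H"
  using B i nz
proof (induction "euclidean_size (B $$ (i, k))" arbitrary: B i rule: less_induct)
  case less
  note B = less.prems(1-3) and i = less.prems(4,5)
  show ?case
  proof (cases "\<forall>j. k \<le> j \<longrightarrow> j < n \<longrightarrow> B $$ (i, k) dvd B $$ (j, k)")
    case True
    then have "B $$ (i, k) dvd 1" using common_divisor_unit[OF B k] by blast
    then show ?thesis using unit_in_column[OF IH k B i] by blast
  next
    case False
    then obtain j where j: "k \<le> j" "j < n" "\<not> B $$ (i, k) dvd B $$ (j, k)" by blast
    let ?q = "B $$ (j, k) div B $$ (i, k)"
    let ?B = "addrow (- ?q) j i B"
    have ne: "j \<noteq> i" using j by auto
    have e: "?B $$ (j, k) = B $$ (j, k) mod B $$ (i, k)"
      using B j k by (simp add: minus_div_mult_eq_mod[symmetric])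
    have "?B \<in> H"
    proof (rule less.hyps[of ?B j])
      show "euclidean_size (?B $$ (j, k)) < euclidean_size (B $$ (i, k))"
        unfolding e using less.prems by (intro mod_size_less)
      show "?B $$ (j, k) \<noteq> 0" unfolding e using j by (simp add: dvd_eq_mod_eq_0)
    qed (use B i j ne k unit_columns_addrow[of k B n i] in \<open>auto simp: det_addrow\<close>)
    then show ?thesis using in_if_addrow_in B i j ne by blast
  qed
qed

lemma unit_columns_suffice_Suc:
  assumes IH: "unit_columns_suffice (Suc k)" and k: "k < n"
  shows "unit_columns_suffice k"
  unfolding unit_columns_suffice_def
proof (intro ballI impI)
  fix B :: "'a mat" assume B: "B \<in> carrier_mat n n" "det B = 1" "unit_columns k B"
  have "\<exists>i. k \<le> i \<and> i < n \<and> B $$ (i, k) \<noteq> 0"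
    using common_divisor_unit[OF B k, of 0] by auto
  then show "B \<in> H" using nonzero_in_column[OF IH k B] by blast
qed

lemma det_1_in:
  assumes "B \<in> carrier_mat n n" "det B = 1"
  shows "B \<in> H"
proof -
  have base: "unit_columns_suffice n"
    unfolding unit_columns_suffice_def
  proof (intro ballI impI)
    fix B :: "'a mat" assume "B \<in> carrier_mat n n" "unit_columns n B"
    then have "B = 1\<^sub>m n" by (intro eq_matI) (auto simp: unit_columns_def)
    then show "B \<in> H" using subgroup.one_closed[OF subgroup] by (simp add: ESL_simps)
  qed
  have "unit_columns_suffice k" if "k \<le> n" for k
    using that base by (induction rule: inc_induct) (auto intro: unit_columns_suffice_Suc)
  from this[of 0] have "unit_columns_suffice 0" by simp
  then show ?thesis using assms by (auto simp: unit_columns_suffice_def unit_columns_def)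
qed

end

section \<open>Multiplying transvections\<close>

lemma addrow_mat_add:
  assumes "i < n" "j < n" "i \<noteq> j"
  shows "addrow_mat n (a + b) i j = addrow_mat n a i j * addrow_mat n b i j"
proof -
  have "addrow_mat n a i j * addrow_mat n b i j = addrow a i j (addrow_mat n b i j)"
    using assms by (subst addrow_mat[where nc = n]) auto
  also have "\<dots> = addrow_mat n (a + b) i j"
    using assms by (intro eq_matI) auto
  finally show ?thesis by simp
qed

lemma addrow_mat_of_int_in_subgroup:
  fixes H :: "'a::comm_ring_1 mat set"
  assumes H: "subgroup H (ESL n)" and ij: "i < n" "j < n" "i \<noteq> j"
    and one: "addrow_mat n 1 i j \<in> H"
  shows "addrow_mat n (of_int k) i j \<in> H"
proof (induction k rule: int_induct[where k = 0])
  case base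
  have "addrow_mat n 0 i j = (1\<^sub>m n :: 'a mat)" by (intro eq_matI) auto
  then show ?case using subgroup.one_closed[OF H] by (simp add: ESL_simps)
next
  have step: "addrow_mat n (of_int (k + 1)) i j \<in> H \<longleftrightarrow> addrow_mat n (of_int k) i j \<in> H" for k
    using group.subgroup_mult_left_iff[OF group_ESL H one, of "addrow_mat n (of_int k) i j"] ij
      addrow_mat_add[of i n j 1 "of_int k :: 'a"]
    by (simp add: ESL_simps det_addrow_mat add.commute)
  { case (step1 k) then show ?case using step[of k] by simp }
  { case (step2 k) then show ?case using step[of "k - 1"] by simp }
qed

text \<open>Conjugation by a signed permutation matrix permutes the transvections and changes their
  coefficients by signs.\<close>

lemma monomial_times_addrow_mat:
  assumes P: "P = mat n n (\<lambda>(a, b). if a = \<sigma> b then s b else 0)" and inj: "inj_on \<sigma> {..<n}"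
    and ij: "i < n" "j < n" "\<sigma> i < n" "\<sigma> j < n" and s: "s j * s j = (1 :: 'a::comm_ring_1)"
  shows "P * addrow_mat n c i j = addrow_mat n (s i * c * s j) (\<sigma> i) (\<sigma> j) * P"
proof (rule eq_matI)
  fix a b assume "a < dim_row (addrow_mat n (s i * c * s j) (\<sigma> i) (\<sigma> j) * P)"
    and "b < dim_col (addrow_mat n (s i * c * s j) (\<sigma> i) (\<sigma> j) * P)"
  then have ab: "a < n" "b < n" by (simp_all add: P)
  have "(P * addrow_mat n c i j) $$ (a, b) =
      (\<Sum>k<n. (if k = b then P $$ (a, k) else 0) + (if k = i then P $$ (a, k) * (if j = b then c else 0) else 0))"
    using ab ij by (auto simp: P scalar_prod_def lessThan_atLeast0 algebra_simps intro!: sum.cong)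
  also have "\<dots> = P $$ (a, b) + P $$ (a, i) * (if j = b then c else 0)"
    using ab ij by (simp add: sum.distrib)
  also have "\<dots> = addrow (s i * c * s j) (\<sigma> i) (\<sigma> j) P $$ (a, b)"
    using ab ij s inj by (auto simp: P inj_on_eq_iff mult.assoc)
  also have "addrow (s i * c * s j) (\<sigma> i) (\<sigma> j) P = addrow_mat n (s i * c * s j) (\<sigma> i) (\<sigma> j) * P"
    using ij by (intro addrow_mat) (auto simp: P)
  finally show "(P * addrow_mat n c i j) $$ (a, b) = (addrow_mat n (s i * c * s j) (\<sigma> i) (\<sigma> j) * P) $$ (a, b)" .
qed (auto simp: P)

section \<open>All integer transvections from three involutions\<close>

text \<open>The rules \<open>mat_eval\<close> bring matrices of explicit size, and their products, into the normal form
  of a list of rows, which decides equations between them.\<close>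

lemma mat_eq_mat_of_rows_list:
  "mat n n f = mat_of_rows_list n (map (\<lambda>i. map (\<lambda>j. f (i, j)) [0..<n]) [0..<n])"
  by (auto simp: mat_of_rows_list_def intro!: eq_matI)

lemma mat_of_rows_list_times:
  assumes "length A = n" "length B = n"
  shows "mat_of_rows_list n A * mat_of_rows_list n B =
    mat_of_rows_list n (map (\<lambda>r. map (\<lambda>j. \<Sum>k\<leftarrow>[0..<n]. r ! k * B ! k ! j) [0..<n]) A)"
  using assms
  by (auto simp: mat_of_rows_list_def scalar_prod_def interv_sum_list_conv_sum_set_nat intro!: eq_matI)

lemma upt_0_5: "[0..<5] = [0, 1, 2, 3, 4]"
  by (simp add: upt_rec)

lemmas mat_eval =
  mat_of_rows_list_times mat_eq_mat_of_rows_list one_mat_def addrow_mat_def upt_0_5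

lemma det_eq_if_square_one:
  fixes A :: "int mat"
  assumes "A \<in> carrier_mat n n" "A * A = 1\<^sub>m n"
  shows "det A = 1 \<or> det A = -1"
  using det_mult[OF assms(1,1)] assms(2) by (auto simp: zmult_eq_1_iff)

lemma generators_squared: "I12 * I12 = 1\<^sub>m 5" "D1 * D1 = 1\<^sub>m 5" "FL * FL = 1\<^sub>m 5"
  by (simp_all add: I12_def D1_def FL_def mat_eval)

lemma generators_in_ESL: "{I12, D1, FL} \<subseteq> carrier (ESL 5)"
proof -
  have "I12 \<in> carrier_mat 5 5" "D1 \<in> carrier_mat 5 5" "FL \<in> carrier_mat 5 5"
    by (rule carrier_matI; simp add: I12_def D1_def FL_def mat_of_rows_list_def)+
  then show ?thesis using generators_squared det_eq_if_square_one by (simp add: ESL_simps)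
qed

lemma det_I12: "det I12 = -1"
proof -
  have "det I12 = prod_list (diag_mat I12)"
    by (rule det_upper_triangular[of _ 5])
      (auto intro!: upper_triangularI simp: I12_def mat_of_rows_list_def less_Suc_eq eval_nat_numeral)
  then show ?thesis by (simp add: diag_mat_def I12_def mat_of_rows_list_def eval_nat_numeral)
qed

abbreviation three_gen :: "int mat set" where
  "three_gen \<equiv> generate (ESL 5) {I12, D1, FL}"

lemma three_gen_subgroup: "subgroup three_gen (ESL 5)"
  using group.generate_is_subgroup[OF group_ESL generators_in_ESL] .

lemma three_gen_mult: "A \<in> three_gen \<Longrightarrow> B \<in> three_gen \<Longrightarrow> A * B \<in> three_gen"
  using generate.eng[of A "ESL 5" _ B] by (simp add: ESL_simps)

lemma three_gen_base: "I12 \<in> three_gen" "D1 \<in> three_gen" "FL \<in> three_gen"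
  by (auto intro: generate.incl)

lemma three_gen_conj: "A \<in> three_gen \<Longrightarrow> B \<in> three_gen \<Longrightarrow> A * B * A \<in> three_gen"
  by (intro three_gen_mult)

text \<open>The reflection \<open>x \<mapsto> x + f x \<cdot> e\<^sub>1\<close> with \<open>f = -2 e\<^sub>1\<^sup>* + v\<close>, where \<open>v\<close> lists the coefficients of
  \<open>e\<^sub>2\<^sup>*, \<dots>, e\<^sub>5\<^sup>*\<close>.\<close>

definition reflection :: "int list \<Rightarrow> int mat" where
  "reflection v = mat_of_rows_list 5
    [(-1) # v, [0, 1, 0, 0, 0], [0, 0, 1, 0, 0], [0, 0, 0, 1, 0], [0, 0, 0, 0, 1]]"

text \<open>Conjugating the reflection for \<open>v\<close> by an element that fixes \<open>e\<^sub>1\<close> and preserves the span of the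
  other basis vectors amounts to composing \<open>v\<close> with the inverse of that element. The reflections \<open>s23\<close>, \<open>s34\<close> and \<open>s32\<close> below are copies of \<open>I12\<close>, moved by
  \<open>D1\<close> and \<open>FL\<close> to other pairs of neighbouring basis vectors. Here \<open>sij\<close> negates \<open>e\<^sub>i\<close>, adds \<open>e\<^sub>i\<close> or \<open>-e\<^sub>i\<close>
  to \<open>e\<^sub>j\<close> and fixes the other basis vectors; so these three, like \<open>FL\<close>, are
  elements of the required kind.\<close>

lemma reflections_in_three_gen:
  "reflection [1, 0, 0, 0] \<in> three_gen" "reflection [0, 0, 0, 1] \<in> three_gen"
  "reflection [0, 1, 0, 0] \<in> three_gen" "reflection [0, 0, 1, 0] \<in> three_gen"
  "reflection [-1, -1, 0, 0] \<in> three_gen" "reflection [-1, 1, -1, 0] \<in> three_gen"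
proof -
  define s23 where "s23 = (FL * D1) * I12 * (D1 * FL)"
  define s34 where "s34 = (FL * D1) * s23 * (D1 * FL)"
  define s32 where "s32 = (FL * D1) * ((FL * D1) * (FL * I12 * FL) * (D1 * FL)) * (D1 * FL)"
  note mult = three_gen_mult three_gen_base
  have s: "s23 \<in> three_gen" "s34 \<in> three_gen" "s32 \<in> three_gen"
    unfolding s23_def s34_def s32_def by (intro mult)+
  have e: "reflection [1, 0, 0, 0] = I12" "reflection [0, 0, 0, 1] = FL * I12 * FL"
    by (simp_all add: reflection_def I12_def FL_def mat_eval)
  have s23: "s23 = mat_of_rows_list 5
    [[1, 0, 0, 0, 0], [0, -1, -1, 0, 0], [0, 0, 1, 0, 0], [0, 0, 0, 1, 0], [0, 0, 0, 0, 1]]"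
    by (simp add: s23_def I12_def FL_def D1_def mat_eval)
  have s34: "s34 = mat_of_rows_list 5
    [[1, 0, 0, 0, 0], [0, 1, 0, 0, 0], [0, 0, -1, 1, 0], [0, 0, 0, 1, 0], [0, 0, 0, 0, 1]]"
    by (simp add: s34_def s23 FL_def D1_def mat_eval)
  have s32: "s32 = mat_of_rows_list 5
    [[1, 0, 0, 0, 0], [0, 1, 0, 0, 0], [0, -1, -1, 0, 0], [0, 0, 0, 1, 0], [0, 0, 0, 0, 1]]"
    by (simp add: s32_def I12_def FL_def D1_def mat_eval)
  show *: "reflection [1, 0, 0, 0] \<in> three_gen" "reflection [0, 0, 0, 1] \<in> three_gen"
    unfolding e by (intro mult)+
  have "reflection [-1, -1, 0, 0] = s23 * reflection [1, 0, 0, 0] * s23"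
    by (simp add: s23 reflection_def mat_eval)
  then show p: "reflection [-1, -1, 0, 0] \<in> three_gen" using three_gen_conj * s by simp
  have "reflection [0, 1, 0, 0] = s32 * reflection [-1, -1, 0, 0] * s32"
    by (simp add: s32 reflection_def mat_eval)
  then show w: "reflection [0, 1, 0, 0] \<in> three_gen" using three_gen_conj p s by simp
  have "reflection [0, 0, 1, 0] = FL * reflection [0, 1, 0, 0] * FL"
    by (simp add: FL_def reflection_def mat_eval)
  then show "reflection [0, 0, 1, 0] \<in> three_gen" using three_gen_conj w three_gen_base by simp
  have "reflection [-1, 1, -1, 0] = s34 * reflection [-1, -1, 0, 0] * s34"
    by (simp add: s34 reflection_def mat_eval)
  then show "reflection [-1, 1, -1, 0] \<in> three_gen" using three_gen_conj p s by simp
qed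

text \<open>Products of two reflections are transvections along the difference of their vectors. The first one
  comes from \<open>(-1, 1, -1, 0) - (-1, -1, 0, 0) + (0, 0, 1, 0) - (0, 1, 0, 0) = (0, 1, 0, 0)\<close>, and
  the others follow because the reflections for all four unit vectors are available.\<close>

lemma first_row_transvections:
  assumes "j < 5" "j \<noteq> 0"
  shows "addrow_mat 5 1 0 j \<in> three_gen"
proof -
  note mult = three_gen_mult reflections_in_three_gen
  have "addrow_mat 5 1 0 2 = reflection [-1, 1, -1, 0] * reflection [-1, -1, 0, 0]
      * reflection [0, 0, 1, 0] * reflection [0, 1, 0, 0]"
    by (simp add: reflection_def mat_eval)
  then have 2: "addrow_mat 5 1 0 2 \<in> three_gen" by (auto intro!: mult)
  have "addrow_mat 5 1 0 1 = addrow_mat 5 1 0 2 * (reflection [1, 0, 0, 0] * reflection [0, 1, 0, 0])"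
    "addrow_mat 5 1 0 3 = addrow_mat 5 1 0 2 * (reflection [0, 0, 1, 0] * reflection [0, 1, 0, 0])"
    "addrow_mat 5 1 0 4 = addrow_mat 5 1 0 2 * (reflection [0, 0, 0, 1] * reflection [0, 1, 0, 0])"
    by (simp_all add: reflection_def mat_eval)
  then have "addrow_mat 5 1 0 1 \<in> three_gen" "addrow_mat 5 1 0 3 \<in> three_gen"
    "addrow_mat 5 1 0 4 \<in> three_gen"
    using 2 by (auto intro!: mult)
  moreover have "j = 1 \<or> j = 2 \<or> j = 3 \<or> j = 4" using assms by linarith
  ultimately show ?thesis using 2 by blast
qed

lemma D1_FL_monomial:
  "D1 * FL = mat 5 5 (\<lambda>(a, b). if a = (b + 4) mod 5 then [-1, -1, 1, -1, 1] ! b else 0)"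
  by (simp add: D1_def FL_def mat_eval)

text \<open>The coefficient \<open>c\<close> of the conjugated transvection is chosen to compensate the signs of the
  monomial matrix \<^term>\<open>D1 * FL\<close>.\<close>

lemma rotate_transvection:
  assumes ij: "i < 5" "j < 5" "i \<noteq> j" and A: "addrow_mat 5 1 i j \<in> three_gen"
  shows "addrow_mat 5 1 ((i + 4) mod 5) ((j + 4) mod 5) \<in> three_gen"
proof -
  define s where "s = (\<lambda>b. [-1, -1, 1, -1, 1 :: int] ! b)"
  define c where "c = s i * s j"
  have sgn: "s b * s b = 1" if "b < 5" for b
    using that by (auto simp: s_def less_Suc_eq eval_nat_numeral)
  have c: "s i * c * s j = 1"
    using sgn[OF ij(1)] sgn[OF ij(2)] by (simp add: c_def algebra_simps)
  have "distinct (map (\<lambda>b. (b + 4) mod 5 :: nat) [0..<5])" by (simp add: upt_0_5)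
  then have inj: "inj_on (\<lambda>b. (b + 4) mod 5 :: nat) {..<5}"
    unfolding distinct_map by (simp add: lessThan_atLeast0)
  have P: "D1 * FL = mat 5 5 (\<lambda>(a, b). if a = (b + 4) mod 5 then s b else 0)"
    unfolding D1_FL_monomial s_def ..
  have conj: "D1 * FL * addrow_mat 5 c i j
      = addrow_mat 5 1 ((i + 4) mod 5) ((j + 4) mod 5) * (D1 * FL)"
    using monomial_times_addrow_mat[OF P inj ij(1,2) _ _ sgn[OF ij(2)], of c] by (simp add: c)
  have "addrow_mat 5 c i j \<in> three_gen"
    using addrow_mat_of_int_in_subgroup[OF three_gen_subgroup ij A, of c] by simp
  then have "D1 * FL * addrow_mat 5 c i j * (FL * D1) \<in> three_gen"
    by (intro three_gen_mult three_gen_base)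
  moreover have "(D1 * FL) * (FL * D1) = 1\<^sub>m 5"
    by (simp add: D1_def FL_def mat_eval)
  then have "D1 * FL * addrow_mat 5 c i j * (FL * D1) = addrow_mat 5 1 ((i + 4) mod 5) ((j + 4) mod 5)"
    unfolding conj using generators_in_ESL
    by (subst assoc_mult_mat[of _ 5 5 _ 5 _ 5]) (auto simp: ESL_simps)
  ultimately show ?thesis by simp
qed

text \<open>Indices count from \<open>0\<close> and a rotation adds \<open>4\<close> to them modulo \<open>5\<close>. Row \<open>0\<close> reaches row \<open>i\<close> after \<open>4 * i\<close>
  rotations, since \<open>4 * 4 = 16\<close> is \<open>1\<close> modulo \<open>5\<close>.\<close>

lemma transvections_in_three_gen:
  assumes "i < 5" "j < 5" "i \<noteq> j"
  shows "addrow_mat 5 1 i j \<in> three_gen"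
proof -
  have "\<forall>j<5. j \<noteq> (4 * m) mod 5 \<longrightarrow> addrow_mat 5 1 ((4 * m) mod 5) j \<in> three_gen" for m :: nat
  proof (induction m)
    case 0
    then show ?case using first_row_transvections by simp
  next
    case (Suc m)
    show ?case
    proof (intro allI impI)
      fix j :: nat assume j: "j < 5" "j \<noteq> (4 * Suc m) mod 5"
      \<comment> \<open>The rotation takes column \<open>l\<close> to column \<open>j\<close>.\<close>
      define l where "l = (j + 1) mod 5"
      have l: "l < 5" by (simp add: l_def)
      have lj: "(l + 4) mod 5 = j" using j(1) unfolding l_def by presburger
      have m: "((4 * m) mod 5 + 4) mod 5 = (4 * Suc m) mod 5" by presburger
      have ne: "l \<noteq> (4 * m) mod 5" using lj m j(2) by metis
      have "addrow_mat 5 1 (((4 * m) mod 5 + 4) mod 5) ((l + 4) mod 5) \<in> three_gen"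
        using Suc[rule_format, OF l ne] by (intro rotate_transvection ne[symmetric] l) simp_all
      then show "addrow_mat 5 1 ((4 * Suc m) mod 5) j \<in> three_gen" unfolding lj m .
    qed
  qed
  from this[of "4 * i"] have "\<forall>j<5. j \<noteq> 4 * (4 * i) mod 5 \<longrightarrow> addrow_mat 5 1 (4 * (4 * i) mod 5) j \<in> three_gen" .
  moreover have "4 * (4 * i) mod 5 = (i + 3 * i * 5) mod 5" by simp
  then have "4 * (4 * i) mod 5 = i" using assms(1) by (simp only: mod_mult_self1 mod_less)
  ultimately show ?thesis using assms by simp
qed

section \<open>Generation over quotients of the integers\<close>

lemma group_hom_ESL_of_int:
  "group_hom (ESL n) (ESL n :: 'a::comm_ring_1 mat monoid) (map_mat of_int)"
proof -
  have "det (map_mat of_int A :: 'a mat) = of_int (det A)" for A :: "int mat"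
    by (rule of_int_hom.hom_det)
  then show ?thesis
    by (intro group_hom.intro group_ESL) (auto simp: group_hom_axioms_def hom_def ESL_simps of_int_hom.mat_hom_mult)
qed

lemma map_addrow_mat: "map_mat of_int (addrow_mat n c i j) = (addrow_mat n (of_int c) i j :: 'a::comm_ring_1 mat)"
  by (intro eq_matI) auto

text \<open>The three matrices reach the transvections with coefficient \<open>1\<close> because their integer versions
  do, and the other coefficients by taking powers. A matrix of determinant \<open>-1\<close> is turned into one of
  determinant \<open>1\<close> by multiplication with \<open>I12\<close>.\<close>

lemma generate_eq_ESL:
  assumes surj: "surj (of_int :: int \<Rightarrow> 'a::euclidean_ring)"
  shows "generate (ESL 5 :: 'a mat monoid) (map_mat of_int ` {I12, D1, FL}) = carrier (ESL 5)"
    (is "?H = _")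
proof -
  interpret h: group_hom "ESL 5" "ESL 5 :: 'a mat monoid" "map_mat of_int"
    by (rule group_hom_ESL_of_int)
  have H: "?H = map_mat of_int ` three_gen"
    using h.generate_img[OF generators_in_ESL] .
  have gens: "map_mat of_int ` {I12, D1, FL} \<subseteq> carrier (ESL 5 :: 'a mat monoid)"
    using generators_in_ESL h.hom_closed by blast
  have sub: "subgroup ?H (ESL 5)" by (rule h.H.generate_is_subgroup[OF gens])
  have E: "addrow_mat 5 c i j \<in> ?H" if ij: "i < 5" "j < 5" "i \<noteq> j" for i j and c :: 'a
  proof -
    obtain k where "c = of_int k" using surj by (metis surjD)
    moreover have "addrow_mat 5 1 i j \<in> ?H"
      using transvections_in_three_gen[OF ij] map_addrow_mat[of 5 1 i j] unfolding H
      by (metis image_eqI of_int_1)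
    ultimately show ?thesis using addrow_mat_of_int_in_subgroup[OF sub ij] by simp
  qed
  have SL: "B \<in> ?H" if "B \<in> carrier_mat 5 5" "det B = 1" for B
    using transvections.det_1_in[OF transvections.intro[OF sub E] that] .
  show ?thesis
  proof (intro equalityI subsetI)
    fix B assume "B \<in> ?H" then show "B \<in> carrier (ESL 5)"
      using subgroup.mem_carrier[OF sub] by blast
  next
    fix B :: "'a mat" assume B: "B \<in> carrier (ESL 5)"
    show "B \<in> ?H"
    proof (cases "det B = 1")
      case True then show ?thesis using B SL by (simp add: ESL_simps)
    next
      case False
      let ?s = "map_mat of_int I12 :: 'a mat"
      have s: "?s \<in> ?H" by (auto intro: generate.incl)
      then have sc: "?s \<in> carrier_mat 5 5" using generators_in_ESL by (simp add: ESL_simps)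
      have "det ?s = -1" using of_int_hom.hom_det[of I12, where 'a = 'a] det_I12 by simp
      then have "det (?s * B) = 1" using det_mult[OF sc, of B] B False by (auto simp: ESL_simps)
      then have "?s * B \<in> ?H" using sc B by (intro SL) (auto simp: ESL_simps)
      then show ?thesis
        using h.H.subgroup_mult_left_iff[OF sub s B] by (simp add: ESL_simps)
    qed
  qed
qed

text \<open>An entry \<open>1\<close> or \<open>-1\<close> off the diagonal distinguishes each of the three matrices from the identity
  even in characteristic \<open>2\<close>.\<close>

lemma involutive_generating_set_three:
  assumes surj: "surj (of_int :: int \<Rightarrow> 'a::euclidean_ring)"
  shows "involutive_generating_set (ESL 5 :: 'a mat monoid) (map_mat of_int ` {I12, D1, FL})"
proof -
  interpret h: group_hom "ESL 5" "ESL 5 :: 'a mat monoid" "map_mat of_int"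
    by (rule group_hom_ESL_of_int)
  have ord: "h.H.ord (map_mat of_int A) = 2"
    if A: "A \<in> carrier (ESL 5)" "A * A = 1\<^sub>m 5" and ij: "i < 5" "j < 5" "i \<noteq> j" "A $$ (i, j) = 1 \<or> A $$ (i, j) = -1"
    for A :: "int mat" and i j
  proof -
    let ?A = "map_mat of_int A :: 'a mat"
    have c: "?A \<in> carrier (ESL 5)" by (rule h.hom_closed[OF A(1)])
    have "?A * ?A = map_mat of_int (A * A)"
      using A h.hom_mult[of A A] by (simp add: ESL_simps)
    then have "?A * ?A = 1\<^sub>m 5" using A of_int_hom.mat_hom_one by metis
    moreover have "?A $$ (i, j) \<noteq> 0" using A ij by (auto simp: ESL_simps)
    then have "?A \<noteq> 1\<^sub>m 5" using ij by auto
    ultimately show ?thesis using h.H.ord_eq_2_iff[OF c] by (simp add: ESL_simps)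
  qed
  have "I12 $$ (0, 1) = 1" "D1 $$ (0, 4) = -1" "FL $$ (1, 4) = 1"
    by (simp_all add: I12_def D1_def FL_def mat_of_rows_list_def)
  then have "\<forall>x \<in> map_mat of_int ` {I12, D1, FL}. h.H.ord x = 2"
    using ord[of I12 0 1] ord[of D1 0 4] ord[of FL 1 4] generators_in_ESL generators_squared by auto
  moreover have "map_mat of_int ` {I12, D1, FL} \<subseteq> carrier (ESL 5 :: 'a mat monoid)"
    using generators_in_ESL h.hom_closed by blast
  ultimately show ?thesis
    using generate_eq_ESL[OF surj] by (simp add: involutive_generating_set_def)
qed

section \<open>Minimality\<close>

text \<open>Take the matrices of two 3-cycles with one common point; their entries are \<open>0\<close> and \<open>1\<close>, so the
  two products differ over every ring with \<open>0 \<noteq> 1\<close>.\<close>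

lemma ESL_squares_not_commuting:
  "\<exists>x \<in> carrier (ESL 5). \<exists>y \<in> carrier (ESL 5 :: 'a::comm_ring_1 mat monoid).
     (x * x) * (y * y) \<noteq> (y * y) * (x * x)"
proof -
  interpret h: group_hom "ESL 5" "ESL 5 :: 'a mat monoid" "map_mat of_int"
    by (rule group_hom_ESL_of_int)
  define X :: "int mat" where "X = mat_of_rows_list 5
    [[0, 0, 1, 0, 0], [1, 0, 0, 0, 0], [0, 1, 0, 0, 0], [0, 0, 0, 1, 0], [0, 0, 0, 0, 1]]"
  define Y :: "int mat" where "Y = mat_of_rows_list 5
    [[1, 0, 0, 0, 0], [0, 1, 0, 0, 0], [0, 0, 0, 0, 1], [0, 0, 1, 0, 0], [0, 0, 0, 1, 0]]"
  define P where "P = (X * X) * (Y * Y)"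
  define Q where "Q = (Y * Y) * (X * X)"
  have XY: "X \<in> carrier_mat 5 5" "Y \<in> carrier_mat 5 5"
    by (rule carrier_matI; simp add: X_def Y_def mat_of_rows_list_def)+
  have cube: "Z \<in> carrier (ESL 5)" if "Z \<in> carrier_mat 5 5" "Z * (Z * Z) = 1\<^sub>m 5" for Z :: "int mat"
  proof -
    have "det Z * det (Z * Z) = 1" using that det_mult[of Z 5 "Z * Z"] by simp
    then show ?thesis using that by (auto simp: ESL_simps zmult_eq_1_iff)
  qed
  have in_ESL: "X \<in> carrier (ESL 5)" "Y \<in> carrier (ESL 5)"
    by (rule cube[OF XY(1)], simp add: X_def mat_eval, rule cube[OF XY(2)], simp add: Y_def mat_eval)
  have PQ: "P \<in> carrier_mat 5 5" "Q \<in> carrier_mat 5 5" using XY by (auto simp: P_def Q_def)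
  have entries: "P $$ (1, 2) = 0" "Q $$ (1, 2) = 1"
    unfolding P_def Q_def by (simp_all add: X_def Y_def mat_eval) (simp_all add: mat_of_rows_list_def)
  have "map_mat of_int P = (map_mat of_int X * map_mat of_int X) * (map_mat of_int Y * map_mat of_int Y :: 'a mat)"
    "map_mat of_int Q = (map_mat of_int Y * map_mat of_int Y) * (map_mat of_int X * map_mat of_int X :: 'a mat)"
    using XY by (simp_all add: P_def Q_def of_int_hom.mat_hom_mult[where n = 5 and nr = 5 and nc = 5])
  moreover have "map_mat of_int P \<noteq> (map_mat of_int Q :: 'a mat)"
  proof
    assume "map_mat of_int P = (map_mat of_int Q :: 'a mat)"
    then have "map_mat of_int P $$ (1, 2) = (map_mat of_int Q :: 'a mat) $$ (1, 2)" by simp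
    then show False using PQ entries by simp
  qed
  ultimately show ?thesis using in_ESL h.hom_closed by metis
qed

text \<open>At most two involutions can be listed as \<open>a\<close> and \<open>b\<close>, if need be with repetition or with the
  identity in place of missing ones.\<close>

lemma involutive_generating_set_card_gt_2:
  assumes T: "involutive_generating_set (ESL 5 :: 'a::comm_ring_1 mat monoid) T" and fin: "finite T"
  shows "card T > 2"
proof (rule ccontr)
  interpret group "ESL 5 :: 'a mat monoid" by (rule group_ESL)
  let ?G = "ESL 5 :: 'a mat monoid"
  have TG: "T \<subseteq> carrier ?G" and gen: "generate ?G T = carrier ?G"
    and inv: "\<And>x. x \<in> T \<Longrightarrow> x \<otimes>\<^bsub>?G\<^esub> x = \<one>\<^bsub>?G\<^esub>"
    using T ord_eq_2_iff by (auto simp: involutive_generating_set_def)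
  assume "\<not> card T > 2"
  then consider "card T = 0" | "card T = 1" | "card T = 2" by linarith
  then have "\<exists>a b. T \<subseteq> {a, b} \<and> {a, b} \<subseteq> insert \<one>\<^bsub>?G\<^esub> T"
  proof cases
    case 1 then show ?thesis using fin by auto
  next
    case 2 then show ?thesis by (auto simp: card_1_singleton_iff)
  next
    case 3 then show ?thesis by (auto simp: card_2_iff)
  qed
  then obtain a b where "T \<subseteq> {a, b}" "{a, b} \<subseteq> insert \<one>\<^bsub>?G\<^esub> T" by blast
  then have ab: "a \<in> carrier ?G" "a \<otimes>\<^bsub>?G\<^esub> a = \<one>\<^bsub>?G\<^esub>" "b \<in> carrier ?G" "b \<otimes>\<^bsub>?G\<^esub> b = \<one>\<^bsub>?G\<^esub>"
    and sub: "T \<subseteq> {a, b}"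
    using TG inv by auto
  have "carrier ?G \<subseteq> generate ?G {a, b}" using mono_generate[OF sub] gen by simp
  then show False
    using squares_commute_if_two_involutions[OF ab] ESL_squares_not_commuting[where 'a = 'a]
    by (auto simp: ESL_simps)
qed

lemma lesspoll_finite_iff:
  assumes "finite S"
  shows "T \<prec> S \<longleftrightarrow> finite T \<and> card T < card S"
proof -
  have e: "S \<approx> {..<card S}" using assms by (simp add: eqpoll_iff_finite_card)
  have "T \<prec> S \<longleftrightarrow> T \<prec> {..<card S}"
    using lesspoll_eq_trans[OF _ e] lesspoll_eq_trans[OF _ eqpoll_sym[OF e]] by iprover
  then show ?thesis by (simp add: lesspoll_iff_finite_card)
qed

lemma minimal_three:
  assumes surj: "surj (of_int :: int \<Rightarrow> 'a::euclidean_ring)"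
  shows "minimal_involutive_generating_set (ESL 5 :: 'a mat monoid) (map_mat of_int ` {I12, D1, FL})"
    and "minimal_involutive_generating_set (ESL 5 :: 'a mat monoid) S \<Longrightarrow> card S = 3"
proof -
  let ?S = "map_mat of_int ` {I12, D1, FL} :: 'a mat set"
  have fin: "finite ?S" and card: "card ?S \<le> 3"
    using card_image_le[of "{I12, D1, FL}" "map_mat of_int :: _ \<Rightarrow> 'a mat"] card_insert_le_m1[of 3]
    by (auto simp: card_insert_if split: if_splits)
  have small: "finite T \<and> card T < 3" if "T \<prec> ?S" for T :: "'a mat set"
    using that fin card lesspoll_finite_iff[OF fin, of T] by simp
  show "minimal_involutive_generating_set (ESL 5 :: 'a mat monoid) ?S"
    using involutive_generating_set_three[OF surj] small involutive_generating_set_card_gt_2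
    unfolding minimal_involutive_generating_set_def by (metis less_Suc_eq not_less_iff_gr_or_eq numeral_3_eq_3 numeral_2_eq_2)
  \<comment> \<open>The three matrices bound the size of any minimal set from above.\<close>
  assume S: "minimal_involutive_generating_set (ESL 5 :: 'a mat monoid) S"
  then have nless: "\<not> ?S \<prec> S" using involutive_generating_set_three[OF surj]
    by (auto simp: minimal_involutive_generating_set_def)
  have "finite S" "card S \<le> 3"
    using nless fin card finite_lesspoll_infinite[of S ?S] lesspoll_finite_iff[of S ?S] by force+
  moreover have "card S > 2"
    using S involutive_generating_set_card_gt_2 \<open>finite S\<close> by (auto simp: minimal_involutive_generating_set_def)
  ultimately show "card S = 3" by simp
qed

theorem proposition2:
  shows "((\<forall>S. minimal_involutive_generating_set (ESL 5 :: int mat monoid) S \<longrightarrow> card S = 3) \<and>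
          minimal_involutive_generating_set (ESL 5 :: int mat monoid) {I12, D1, FL}) \<and>
         ((\<forall>S. minimal_involutive_generating_set
               (ESL 5 :: 'p::prime_card mod_ring mat monoid) S \<longrightarrow> card S = 3) \<and>
          minimal_involutive_generating_set (ESL 5 :: 'p::prime_card mod_ring mat monoid)
            {map_mat of_int I12, map_mat of_int D1, map_mat of_int FL})"
proof -
  have "surj (of_int :: int \<Rightarrow> int)" by simp
  moreover have "map_mat of_int A = (A :: int mat)" for A by (intro eq_matI) auto
  moreover have "surj (of_int :: int \<Rightarrow> 'p mod_ring)"
    unfolding of_int_of_int_mod_ring by (metis of_int_mod_ring_to_int_mod_ring surjI)
  ultimately show ?thesis
    using minimal_three[where 'a = int] minimal_three[where 'a = "'p mod_ring"] by simp
qed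

end
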